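(* Let $r\ge 1$ be an integer, let $\Gamma$ be a congruence subgroup of $\mathrm{SL}(2,\mathbb{Z})$, let $f\in M_k(\Gamma)$ be an elliptic modular form of weight $k$ on $\Gamma$, and let $I$ be an invariant, of degree $d$ and order $n$, of a binary form $\sum_{i=0}^r a_i\binom{r}{i}x_1^{r-i}x_2^i$ of degree $r$. Let $\Psi(I,f)$ be the function on the upper half plane obtained from the polynomial $I=I(a_0,\ldots,a_r)$ by the substitution $$a_i\mapsto i!\,\binom{k+r-1}{i}\,f^{(r-i)}\qquad (i=0,\ldots,r).$$ Then $\Psi(I,f)$ is a modular form of weight $dk+2n$ on $\Gamma$, so that one obtains a map $$\Psi:\ \mathcal{I}_d(V_r)\times M_k(\Gamma)\longrightarrow M_{dk+2n}(\Gamma).$$ Moreover, for fixed $f\in M_k(\Gamma)$, the map $I\mapsto \Psi(I,f)$ defines a ring homomorphism $\mathcal{I}(V_r)\to R(\Gamma)$.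
   Context: For a congruence subgroup $\Gamma\subset \mathrm{SL}(2,\mathbb{Z})$, $M_k(\Gamma)$ is the complex vector space of holomorphic modular forms of weight $k$ on $\Gamma$ (holomorphic on the upper half plane $\mathfrak{H}$, with variable $\tau$, and holomorphic at all cusps), and $R(\Gamma)=\bigoplus_k M_k(\Gamma)$ is the ring of modular forms on $\Gamma$. For $m\ge 0$, $f^{(m)}=d^mf/d\tau^m$. Let $V=\langle x_1,x_2\rangle$ be the two-dimensional complex vector space with basis $x_1,x_2$, with the natural action of $\mathrm{GL}(V)=\mathrm{GL}(2)$, and let $V_r=\mathrm{Sym}^r(V)$, whose elements are written as binary forms $\sum_{i=0}^r a_i\binom{r}{i}x_1^{r-i}x_2^i$. An invariant of binary forms of degree $r$ is a (homogeneous) polynomial with complex coefficients in $a_0,\ldots,a_r$ that is invariant under the action of $\mathrm{SL}(V)$. Its degree $d$ is its degree as a polynomial in the $a_i$. It has order $n$ if for each of its monomials the sum of the indices of the $a_i$ occurring (with multiplicity) equals $n$; equivalently, it changes under $\mathrm{GL}(V)$ by the $n$th power of the determinant. For an invariant of degree $d$ and order $n$ one has $dr=2n$. The invariants form a graded ring $\mathcal{I}(V_r)=\bigoplus_d\mathcal{I}_d(V_r)$, graded by the degree; the map $I\mapsto\Psi(I,f)$ is defined on all of $\mathcal{I}(V_r)$ by the same substitution. *)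

theory Defs
  imports
    "HOL-Complex_Analysis.Complex_Analysis"
    "HOL-Number_Theory.Cong"
    "HOL-Algebra.RingHom"
    "HOL-Library.Poly_Mapping"
begin

section \<open>Congruence subgroups\<close>

definition SL2Z :: "(int^2^2) monoid" where
  "SL2Z = \<lparr>carrier = {A. det A = 1}, mult = (**), one = mat 1\<rparr>"

definition principal_congruence_subgroup :: "nat \<Rightarrow> (int^2^2) set" where
  "principal_congruence_subgroup N =
     {A \<in> carrier SL2Z. \<forall>i j. [A $ i $ j = (mat 1 :: int^2^2) $ i $ j] (mod int N)}"

definition congruence_subgroup :: "(int^2^2) set \<Rightarrow> bool" where
  "congruence_subgroup \<Gamma> \<longleftrightarrow>
     subgroup \<Gamma> SL2Z \<and> (\<exists>N\<ge>1. principal_congruence_subgroup N \<subseteq> \<Gamma>)"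

section \<open>Modular forms\<close>

text \<open>
  Functions on the upper half plane are represented by total functions that vanish off it, so that
  equality of functions is equality on the upper half plane.
\<close>

definition upper_half_plane :: "complex set" where
  "upper_half_plane = {\<tau>. Im \<tau> > 0}"

definition moeb :: "int^2^2 \<Rightarrow> complex \<Rightarrow> complex" where
  "moeb A = moebius (of_int (A$1$1)) (of_int (A$1$2)) (of_int (A$2$1)) (of_int (A$2$2))"

definition automorphy :: "int^2^2 \<Rightarrow> complex \<Rightarrow> complex" where
  "automorphy A \<tau> = of_int (A$2$1) * \<tau> + of_int (A$2$2)"

definition slash :: "int \<Rightarrow> (complex \<Rightarrow> complex) \<Rightarrow> int^2^2 \<Rightarrow> complex \<Rightarrow> complex" where
  "slash k f A \<tau> = automorphy A \<tau> powi (- k) * f (moeb A \<tau>)"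

text \<open>
  Holomorphy at \<open>\<infinity>\<close>: the function is a holomorphic function of the local parameter
  \<open>exp (2\<pi>i\<tau>/N)\<close> on the full unit disc, including its centre.
\<close>

definition holomorphic_at_infinity :: "(complex \<Rightarrow> complex) \<Rightarrow> bool" where
  "holomorphic_at_infinity g \<longleftrightarrow>
     (\<exists>N::nat. N \<ge> 1 \<and> (\<exists>F. F holomorphic_on ball 0 1 \<and>
        (\<forall>\<tau>\<in>upper_half_plane. g \<tau> = F (exp (2 * of_real pi * \<i> * \<tau> / of_nat N)))))"

text \<open>
  The cusps of \<open>\<Gamma>\<close> are the translates of \<open>\<infinity>\<close> under the full modular group; holomorphy at the cusp
  \<open>A\<infinity>\<close> is holomorphy at \<open>\<infinity>\<close> of \<open>f\<close> slashed with \<open>A\<close>.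
\<close>

definition modular_forms :: "int \<Rightarrow> (int^2^2) set \<Rightarrow> (complex \<Rightarrow> complex) set" where
  "modular_forms k \<Gamma> = {f.
     (\<forall>\<tau>. \<tau> \<notin> upper_half_plane \<longrightarrow> f \<tau> = 0) \<and>
     f holomorphic_on upper_half_plane \<and>
     (\<forall>A\<in>\<Gamma>. \<forall>\<tau>\<in>upper_half_plane. f (moeb A \<tau>) = automorphy A \<tau> powi k * f \<tau>) \<and>
     (\<forall>A\<in>carrier SL2Z. holomorphic_at_infinity (slash k f A))}"

text \<open>
  The ring of modular forms, as the internal sum of the spaces \<^term>\<open>modular_forms k \<Gamma>\<close>; that this
  sum is direct is the lemma \<open>modular_forms_direct\<close> below.
\<close>

definition modular_forms_ring :: "(int^2^2) set \<Rightarrow> (complex \<Rightarrow> complex) ring" where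
  "modular_forms_ring \<Gamma> =
     \<lparr>carrier = {(\<lambda>\<tau>. \<Sum>k\<in>K. g k \<tau>) | K g. finite K \<and> (\<forall>k\<in>K. g k \<in> modular_forms k \<Gamma>)},
      mult = (\<lambda>f g \<tau>. f \<tau> * g \<tau>),
      one = (\<lambda>\<tau>. if \<tau> \<in> upper_half_plane then 1 else 0),
      zero = (\<lambda>\<tau>. 0),
      add = (\<lambda>f g \<tau>. f \<tau> + g \<tau>)\<rparr>"

lemma modular_forms_direct:
  assumes \<Gamma>: "congruence_subgroup \<Gamma>" and K: "finite K"
    and g: "\<And>k. k \<in> K \<Longrightarrow> g k \<in> modular_forms k \<Gamma>"
    and sum0: "\<And>\<tau>. (\<Sum>k\<in>K. g k \<tau>) = 0" and k: "k \<in> K"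
  shows "g k = (\<lambda>_. 0)"
proof
  fix \<tau>
  show "g k \<tau> = 0"
  proof (cases "\<tau> \<in> upper_half_plane")
    case False
    then show ?thesis using g[OF k] by (auto simp: modular_forms_def)
  next
    case True
    then have im: "Im \<tau> > 0" by (simp add: upper_half_plane_def)
    obtain N where N: "N \<ge> 1" "principal_congruence_subgroup N \<subseteq> \<Gamma>"
      using \<Gamma> by (auto simp: congruence_subgroup_def)
    define A :: "nat \<Rightarrow> int^2^2" where
      "A j = (\<chi> p q. if p = q then 1 else if p = 2 then int j * int N else 0)" for j
    have entries: "A j $ 1 $ 1 = 1" "A j $ 1 $ 2 = 0" "A j $ 2 $ 1 = int j * int N" "A j $ 2 $ 2 = 1"
      for j by (auto simp: A_def)
    have AG: "A j \<in> \<Gamma>" for j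
    proof -
      have "A j \<in> carrier SL2Z" by (simp add: SL2Z_def det_2 entries)
      moreover have "[A j $ p $ q = (mat 1 :: int^2^2) $ p $ q] (mod int N)" for p q
        by (auto simp: A_def mat_def cong_def)
      ultimately show ?thesis using N(2) by (auto simp: principal_congruence_subgroup_def)
    qed
    define z where "z j = automorphy (A j) \<tau>" for j
    have z: "z j = of_nat (j * N) * \<tau> + 1" for j by (simp add: z_def automorphy_def entries)
    have z0: "z j \<noteq> 0" for j
    proof
      assume 0: "z j = 0"
      then have "Im (z j) = 0" by simp
      then have "real (j * N) * Im \<tau> = 0" unfolding z by simp
      then have "j * N = 0" using im by (auto simp del: of_nat_mult)
      with 0 show False unfolding z by auto
    qed
    have "inj z"
    proof (rule injI)
      fix i j assume "z i = z j"
      then have "Im (z i) = Im (z j)" by simp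
      then have "real (i * N) * Im \<tau> = real (j * N) * Im \<tau>" unfolding z by simp
      then have "real (i * N) = real (j * N)" using im by (simp del: of_nat_mult)
      then show "i = j" using N(1) by (simp del: of_nat_mult)
    qed
    then have inf: "infinite (range z)" by (rule range_inj_infinite)
    define m where "m = (\<Sum>l\<in>K. \<bar>l\<bar>)"
    have m: "l + m \<ge> 0" if "l \<in> K" for l
    proof -
      have "\<bar>l\<bar> \<le> m" unfolding m_def by (rule member_le_sum[OF that _ K]) auto
      then show ?thesis by linarith
    qed
    define p where "p = (\<Sum>l\<in>K. Polynomial.monom (g l \<tau>) (nat (l + m)))"
    have roots: "poly p (z j) = 0" for j
    proof -
      have "poly p (z j) = (\<Sum>l\<in>K. g l \<tau> * z j ^ nat (l + m))"
        by (simp add: p_def poly_sum poly_monom)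
      also have "\<dots> = (\<Sum>l\<in>K. z j powi m * g l (moeb (A j) \<tau>))"
      proof (rule sum.cong[OF refl])
        fix l assume l: "l \<in> K"
        have "g l (moeb (A j) \<tau>) = z j powi l * g l \<tau>"
          using g[OF l] AG[of j] True by (auto simp: modular_forms_def z_def)
        moreover have "z j ^ nat (l + m) = z j powi l * z j powi m"
        proof -
          have "z j ^ nat (l + m) = z j powi (l + m)" using m[OF l] by (simp add: power_int_def)
          then show ?thesis using z0[of j] by (simp add: power_int_add)
        qed
        ultimately show "g l \<tau> * z j ^ nat (l + m) = z j powi m * g l (moeb (A j) \<tau>)" by simp
      qed
      also have "\<dots> = 0" by (simp add: sum0 flip: sum_distrib_left)
      finally show ?thesis .
    qed
    have "p = 0"
    proof (rule ccontr)
      assume "p \<noteq> 0"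
      then have "finite {x. poly p x = 0}" by (rule poly_roots_finite)
      moreover have "range z \<subseteq> {x. poly p x = 0}" using roots by auto
      ultimately show False using inf finite_subset by blast
    qed
    then have "0 = poly.coeff p (nat (k + m))" by simp
    also have "\<dots> = (\<Sum>l\<in>K. if l = k then g l \<tau> else 0)"
      unfolding p_def coeff_sum
      by (rule sum.cong) (use m k in \<open>auto simp: eq_nat_nat_iff\<close>)
    also have "\<dots> = g k \<tau>" using K k by simp
    finally show ?thesis by simp
  qed
qed

section \<open>Invariants of binary forms\<close>

text \<open>Polynomials in variables indexed by natural numbers, with complex coefficients.\<close>

type_synonym cpoly = "(nat \<Rightarrow>\<^sub>0 nat) \<Rightarrow>\<^sub>0 complex"

definition Const :: "complex \<Rightarrow> cpoly" where
  "Const c = Poly_Mapping.single 0 c"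

definition Var :: "nat \<Rightarrow> cpoly" where
  "Var i = Poly_Mapping.single (Poly_Mapping.single i 1) 1"

definition eval_poly :: "(nat \<Rightarrow> complex) \<Rightarrow> cpoly \<Rightarrow> complex" where
  "eval_poly a I = (\<Sum>p\<in>Poly_Mapping.keys I. Poly_Mapping.lookup I p *
     (\<Prod>i\<in>Poly_Mapping.keys p. a i ^ Poly_Mapping.lookup p i))"

text \<open>
  \<open>binary_form r a u v\<close> is the form with coefficients \<open>a 0, \<dots>, a r\<close>, with \<open>u\<close> and \<open>v\<close> in the place of
  the basis vectors \<open>x\<^sub>1\<close> and \<open>x\<^sub>2\<close>; these themselves are \<^term>\<open>Var 1\<close> and \<^term>\<open>Var 2\<close>.
\<close>

definition binary_form :: "nat \<Rightarrow> (nat \<Rightarrow> complex) \<Rightarrow> cpoly \<Rightarrow> cpoly \<Rightarrow> cpoly" where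
  "binary_form r a u v = (\<Sum>i\<le>r. Const (a i * of_nat (r choose i)) * u ^ (r - i) * v ^ i)"

text \<open>
  The action of a matrix on \<open>Sym\<^sup>r V\<close>, induced by \<open>x\<^sub>j \<mapsto> g\<^sub>1\<^sub>j x\<^sub>1 + g\<^sub>2\<^sub>j x\<^sub>2\<close>, and the resulting action on
  the coefficients \<open>a i\<close> (\<open>i \<le> r\<close>) of a form; the latter divides the coefficient of
  \<open>x\<^sub>1\<^bsup>r-i\<^esup> x\<^sub>2\<^bsup>i\<^esup>\<close> by the binomial factor built into \<^const>\<open>binary_form\<close>.
\<close>

definition act_form :: "nat \<Rightarrow> complex^2^2 \<Rightarrow> (nat \<Rightarrow> complex) \<Rightarrow> cpoly" where
  "act_form r g a = binary_form r a
     (Const (g$1$1) * Var 1 + Const (g$2$1) * Var 2)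
     (Const (g$1$2) * Var 1 + Const (g$2$2) * Var 2)"

definition act_coeff :: "nat \<Rightarrow> complex^2^2 \<Rightarrow> (nat \<Rightarrow> complex) \<Rightarrow> nat \<Rightarrow> complex" where
  "act_coeff r g a i =
     Poly_Mapping.lookup (act_form r g a)
       (Poly_Mapping.single 1 (r - i) + Poly_Mapping.single 2 i) / of_nat (r choose i)"

definition homogeneous_of_degree :: "nat \<Rightarrow> cpoly \<Rightarrow> bool" where
  "homogeneous_of_degree d I \<longleftrightarrow>
     (\<forall>p\<in>Poly_Mapping.keys I. (\<Sum>i\<in>Poly_Mapping.keys p. Poly_Mapping.lookup p i) = d)"

definition has_order :: "nat \<Rightarrow> cpoly \<Rightarrow> bool" where
  "has_order n I \<longleftrightarrow>
     (\<forall>p\<in>Poly_Mapping.keys I. (\<Sum>i\<in>Poly_Mapping.keys p. i * Poly_Mapping.lookup p i) = n)"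

definition invariants :: "nat \<Rightarrow> nat \<Rightarrow> cpoly set" where
  "invariants r d = {I.
     (\<forall>p\<in>Poly_Mapping.keys I. Poly_Mapping.keys p \<subseteq> {..r}) \<and>
     homogeneous_of_degree d I \<and>
     (\<forall>g a. det g = 1 \<longrightarrow> eval_poly (act_coeff r g a) I = eval_poly a I)}"

definition invariant_ring :: "nat \<Rightarrow> cpoly ring" where
  "invariant_ring r =
     \<lparr>carrier = {(\<Sum>d\<in>D. J d) | D J. finite D \<and> (\<forall>d\<in>D. J d \<in> invariants r d)},
      mult = (*), one = 1, zero = 0, add = (+)\<rparr>"

section \<open>The map \<open>\<Psi>\<close>\<close>

text \<open>
  The binomial coefficient is the generalized one, since \<open>k + r - 1\<close> is an integer that may be
  negative.
\<close>

definition Psi :: "nat \<Rightarrow> int \<Rightarrow> cpoly \<Rightarrow> (complex \<Rightarrow> complex) \<Rightarrow> complex \<Rightarrow> complex" where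
  "Psi r k I f \<tau> =
     (if \<tau> \<in> upper_half_plane
      then eval_poly (\<lambda>i. fact i * (of_int (k + int r - 1) gchoose i) * (deriv ^^ (r - i)) f \<tau>) I
      else 0)"

end

(*
  If h is the weight k slash of f by A = (a b; c d) and J = c tau + d, then f^(m)(A tau) is a
  combination of the products c^j J^(k+2m-j) h^(m-j)(tau).  Weighted by i! binom(k+r-1, i), the
  derivatives f^(r-i) become the coefficients of a binary form on which passing from tau to A tau
  acts, up to the scalar J^(k+r), through a matrix of determinant 1.  An invariant of degree d does
  not see the matrix, and the scalar contributes J^(d(k+r)); this also holds for A outside Gamma,
  which settles the cusps.  Finally dr = 2n, as one sees on the matrices diag(t, 1/t).
*)

theory Submission
  imports Defs "HOL-Library.Function_Algebras"
begin

text \<open>The factors \<open>i! binom(k+r-1, i)\<close> are forced by the derivative formula. The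
  coefficients of f^(m)(A tau) are binom(m, j) times the falling factorial (k+m-1)...(k+m-j). For m
  = r-i the latter starts at k+r-1-i, exactly where the falling factorial of length i from k+r-1
  stops; the two join to the factor of index i+j, and only binom(r-i, j) survives. This is how an
  upper triangular matrix acts on the coefficients of a form once they are normalised by binom(r,
  i). The exponent of J is k+2(r-i)-j = (k+r) + (r-i-j) - i, so taking out J^(k+r) leaves the
  diagonal entries J and 1/J. The matrix varies with tau and is not integral; invariance under
  complex matrices of determinant 1 is applied at each tau separately, so the action has to be
  computed for triangular matrices only. At the cusps, differentiation is harmless because d/dtau is
  a multiple of q d/dq in the local parameter q. One degenerate case remains: the zero polynomial
  has every order, so dr = 2n can be derived only from an invariant with a nonzero value.\<close>

no_notation fps_nth (infixl "$" 75)

section \<open>Evaluation of polynomials\<close>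

definition eval_monom :: "(nat \<Rightarrow> complex) \<Rightarrow> (nat \<Rightarrow>\<^sub>0 nat) \<Rightarrow> complex" where
  "eval_monom a p = (\<Prod>i\<in>Poly_Mapping.keys p. a i ^ Poly_Mapping.lookup p i)"

lemma eval_monom_superset:
  assumes "finite S" and "Poly_Mapping.keys p \<subseteq> S"
  shows "eval_monom a p = (\<Prod>i\<in>S. a i ^ Poly_Mapping.lookup p i)"
  unfolding eval_monom_def
  by (rule prod.mono_neutral_left) (use assms in \<open>auto simp: in_keys_iff\<close>)

lemma eval_monom_add: "eval_monom a (p + q) = eval_monom a p * eval_monom a q"
proof -
  let ?S = "Poly_Mapping.keys p \<union> Poly_Mapping.keys q"
  have "eval_monom a (p + q) = (\<Prod>i\<in>?S. a i ^ Poly_Mapping.lookup (p + q) i)"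
    by (rule eval_monom_superset) (use keys_add[of p q] in auto)
  also have "\<dots> = (\<Prod>i\<in>?S. a i ^ Poly_Mapping.lookup p i) * (\<Prod>i\<in>?S. a i ^ Poly_Mapping.lookup q i)"
    by (simp add: lookup_add power_add prod.distrib)
  finally show ?thesis by (simp add: eval_monom_superset[of ?S])
qed

lemma eval_poly_superset:
  assumes "finite S" and "Poly_Mapping.keys I \<subseteq> S"
  shows "eval_poly a I = (\<Sum>p\<in>S. Poly_Mapping.lookup I p * eval_monom a p)"
  unfolding eval_poly_def eval_monom_def[symmetric]
  by (rule sum.mono_neutral_left) (use assms in \<open>auto simp: in_keys_iff\<close>)

lemma eval_poly_eq: "eval_poly a I = (\<Sum>p\<in>Poly_Mapping.keys I. Poly_Mapping.lookup I p * eval_monom a p)"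
  by (simp add: eval_poly_superset)

lemma eval_poly_zero: "eval_poly a 0 = 0"
  by (simp add: eval_poly_eq)

lemma eval_poly_single: "eval_poly a (Poly_Mapping.single p c) = c * eval_monom a p"
  by (simp add: eval_poly_eq)

lemma eval_poly_one: "eval_poly a 1 = 1"
  by (simp add: eval_poly_single eval_monom_def flip: single_one)

lemma eval_poly_add: "eval_poly a (I + J) = eval_poly a I + eval_poly a J"
proof -
  let ?S = "Poly_Mapping.keys I \<union> Poly_Mapping.keys J"
  have "eval_poly a (I + J) = (\<Sum>p\<in>?S. Poly_Mapping.lookup (I + J) p * eval_monom a p)"
    by (rule eval_poly_superset) (use keys_add[of I J] in auto)
  then show ?thesis
    by (simp add: eval_poly_superset[of ?S] lookup_add distrib_right sum.distrib)
qed

lemma eval_poly_uminus: "eval_poly a (- I) = - eval_poly a I"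
  using eval_poly_add[of a I "- I"] by (simp add: eval_poly_zero eq_neg_iff_add_eq_0 add.commute)

lemma eval_poly_sum: "eval_poly a (\<Sum>x\<in>X. g x) = (\<Sum>x\<in>X. eval_poly a (g x))"
  by (induction X rule: infinite_finite_induct) (auto simp: eval_poly_zero eval_poly_add)

lemma cpoly_sum_monomials:
  "(\<Sum>p\<in>Poly_Mapping.keys I. Poly_Mapping.single p (Poly_Mapping.lookup I p)) = (I :: cpoly)"
  by (rule poly_mapping_eqI) (auto simp: lookup_sum lookup_single when_def in_keys_iff)

lemma eval_poly_mult: "eval_poly a (I * J) = eval_poly a I * eval_poly a J"
proof -
  have "I * J = (\<Sum>p\<in>Poly_Mapping.keys I. \<Sum>q\<in>Poly_Mapping.keys J.
      Poly_Mapping.single (p + q) (Poly_Mapping.lookup I p * Poly_Mapping.lookup J q))"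
    by (subst cpoly_sum_monomials[symmetric, of I], subst cpoly_sum_monomials[symmetric, of J])
      (simp add: sum_product mult_single)
  then show ?thesis
    by (simp add: eval_poly_sum eval_poly_single eval_monom_add eval_poly_eq[of a I]
        eval_poly_eq[of a J] sum_product mult_ac)
qed

text \<open>Applied with \<open>V = {..r}\<close>: the formulas for transformed coefficients are
  established only for indices up to \<open>r\<close>, and an invariant contains no other
  variables.\<close>

lemma eval_poly_cong:
  assumes "\<forall>p\<in>Poly_Mapping.keys I. Poly_Mapping.keys p \<subseteq> V" and "\<And>i. i \<in> V \<Longrightarrow> a i = b i"
  shows "eval_poly a I = eval_poly b I"
  unfolding eval_poly_def by (intro sum.cong prod.cong arg_cong2[where f = "(*)"] arg_cong2[where f = "(^)"] refl)
    (use assms in blast)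

lemma eval_poly_homogeneous:
  assumes "homogeneous_of_degree d I"
  shows "eval_poly (\<lambda>i. c * a i) I = c ^ d * eval_poly a I"
proof -
  have "eval_monom (\<lambda>i. c * a i) p = c ^ d * eval_monom a p" if "p \<in> Poly_Mapping.keys I" for p
    using assms that
    by (auto simp: eval_monom_def power_mult_distrib prod.distrib homogeneous_of_degree_def
        simp flip: power_sum)
  then show ?thesis by (simp add: eval_poly_eq sum_distrib_left mult_ac)
qed

lemma eval_poly_order:
  assumes "has_order n I"
  shows "eval_poly (\<lambda>i. c ^ i * a i) I = c ^ n * eval_poly a I"
proof -
  have "eval_monom (\<lambda>i. c ^ i * a i) p = c ^ n * eval_monom a p" if "p \<in> Poly_Mapping.keys I" for p
    using assms that
    by (auto simp: eval_monom_def power_mult_distrib prod.distrib has_order_def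
        simp flip: power_sum power_mult)
  then show ?thesis by (simp add: eval_poly_eq sum_distrib_left mult_ac)
qed

section \<open>Graded rings\<close>

text \<open>The common shape of the carriers of \<open>invariant_ring\<close> (indexed by degrees in
  \<open>nat\<close>) and \<open>modular_forms_ring\<close> (indexed by weights in
  \<open>int\<close>), so that the ring axioms are checked once for both.\<close>

definition graded_span :: "('i \<Rightarrow> 'a::comm_monoid_add set) \<Rightarrow> 'a set" where
  "graded_span M = {(\<Sum>i\<in>K. g i) | K g. finite K \<and> (\<forall>i\<in>K. g i \<in> M i)}"

lemma graded_spanI: "finite K \<Longrightarrow> (\<And>i. i \<in> K \<Longrightarrow> g i \<in> M i) \<Longrightarrow> (\<Sum>i\<in>K. g i) \<in> graded_span M"
  unfolding graded_span_def by blast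

lemma component_in_graded_span: "x \<in> M i \<Longrightarrow> x \<in> graded_span M"
  using graded_spanI[of "{i}" "\<lambda>_. x" M] by simp

lemma zero_in_graded_span: "0 \<in> graded_span M"
  using graded_spanI[of "{}" _ M] by simp

locale graded =
  fixes M :: "'i::plus \<Rightarrow> 'a::comm_ring set"
  assumes zero: "0 \<in> M i"
    and add: "x \<in> M i \<Longrightarrow> y \<in> M i \<Longrightarrow> x + y \<in> M i"
    and uminus: "x \<in> M i \<Longrightarrow> - x \<in> M i"
    and mult: "x \<in> M i \<Longrightarrow> y \<in> M j \<Longrightarrow> x * y \<in> M (i + j)"
begin

lemma add_graded_span:
  assumes "x \<in> graded_span M" and "y \<in> graded_span M"
  shows "x + y \<in> graded_span M"
proof -
  obtain K g L h where x: "x = (\<Sum>i\<in>K. g i)" "finite K" "\<forall>i\<in>K. g i \<in> M i"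
    and y: "y = (\<Sum>i\<in>L. h i)" "finite L" "\<forall>i\<in>L. h i \<in> M i"
    using assms unfolding graded_span_def by blast
  \<comment> \<open>Both families are padded by zeros to a common index set; since every
    \<open>M i\<close> contains 0, the padded families are still homogeneous and can be added
    componentwise.\<close>
  have "x = (\<Sum>i\<in>K \<union> L. if i \<in> K then g i else 0)" "y = (\<Sum>i\<in>K \<union> L. if i \<in> L then h i else 0)"
    unfolding x(1) y(1) using x(2) y(2) by (auto intro!: sum.mono_neutral_cong_left)
  then have "x + y = (\<Sum>i\<in>K \<union> L. (if i \<in> K then g i else 0) + (if i \<in> L then h i else 0))"
    by (simp only: sum.distrib)
  also have "\<dots> \<in> graded_span M"
    by (rule graded_spanI) (use x y add zero in auto)
  finally show ?thesis .
qed

lemma sum_graded_span: "(\<And>x. x \<in> X \<Longrightarrow> f x \<in> graded_span M) \<Longrightarrow> (\<Sum>x\<in>X. f x) \<in> graded_span M"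
  by (induction X rule: infinite_finite_induct) (auto simp: zero_in_graded_span add_graded_span)

lemma uminus_graded_span:
  assumes "x \<in> graded_span M"
  shows "- x \<in> graded_span M"
  using assms graded_spanI[of _ "\<lambda>i. - g i" M for g] uminus
  by (auto simp: graded_span_def simp flip: sum_negf)

lemma mult_graded_span:
  assumes "x \<in> graded_span M" and "y \<in> graded_span M"
  shows "x * y \<in> graded_span M"
proof -
  obtain K g L h where x: "x = (\<Sum>i\<in>K. g i)" "finite K" "\<forall>i\<in>K. g i \<in> M i"
    and y: "y = (\<Sum>i\<in>L. h i)" "finite L" "\<forall>i\<in>L. h i \<in> M i"
    using assms unfolding graded_span_def by blast
  have "g i * h j \<in> graded_span M" if "i \<in> K" "j \<in> L" for i j
    by (rule component_in_graded_span[where i = "i + j"]) (use that x y mult in auto)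
  then show ?thesis
    unfolding x(1) y(1) sum_product by (intro sum_graded_span)
qed

text \<open>The unit is a parameter because it may differ from the ambient 1: in
  \<open>modular_forms_ring\<close> it is the function that is 1 on the upper half plane and 0 off
  it. By distributivity it suffices to test it on homogeneous elements.\<close>

lemma cring_graded_span:
  assumes e: "e \<in> graded_span M" and unit: "\<And>i x. x \<in> M i \<Longrightarrow> e * x = x"
  shows "cring \<lparr>carrier = graded_span M, mult = (*), one = e, zero = 0, add = (+)\<rparr>"
proof (rule cringI)
  have unit': "e * x = x" if x: "x \<in> graded_span M" for x
  proof -
    obtain K g where "x = (\<Sum>i\<in>K. g i)" "\<forall>i\<in>K. g i \<in> M i"
      using x unfolding graded_span_def by blast
    moreover from this have "e * g i = g i" if "i \<in> K" for i
      using that unit[of "g i" i] by blast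
    ultimately show ?thesis by (simp add: sum_distrib_left)
  qed
  show "abelian_group \<lparr>carrier = graded_span M, mult = (*), one = e, zero = 0, add = (+)\<rparr>"
    by (rule abelian_groupI)
      (auto simp: add_graded_span zero_in_graded_span add_ac intro!: bexI[OF _ uminus_graded_span])
  show "Group.comm_monoid \<lparr>carrier = graded_span M, mult = (*), one = e, zero = 0, add = (+)\<rparr>"
    by (rule Group.comm_monoidI) (simp_all add: mult_graded_span e unit' mult.assoc mult.commute[of _ e],
      simp add: mult.commute)
qed (simp add: distrib_right)

end

section \<open>The action of triangular matrices\<close>

lemma Const_mult: "Const a * Const b = Const (a * b)"
  by (simp add: Const_def mult_single)

lemma Const_power: "Const a ^ n = Const (a ^ n)"
  by (induction n) (simp_all add: Const_mult, simp add: Const_def)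

lemma Const_of_nat: "of_nat n = Const (of_nat n)"
  by (simp add: Const_def)

lemma Var_power: "Var i ^ n = Poly_Mapping.single (Poly_Mapping.single i n) 1"
  by (induction n) (simp_all add: Var_def mult_single flip: single_add)

lemma Const_Var_monomial:
  "Const c * (Var 1 ^ p * Var 2 ^ q)
     = Poly_Mapping.single (Poly_Mapping.single 1 p + Poly_Mapping.single 2 q) c"
  by (simp add: Const_def Var_power mult_single)

text \<open>If \<open>g $ 2 $ 1 = 0\<close>, then x_1 goes to a multiple of itself, so only the
  power of the image of x_2 needs the binomial theorem. The exponents of x_1 combine as (r - l) + (l
  - i) = r - i.\<close>

lemma act_form_triangular:
  fixes g :: "complex^2^2"
  assumes "g $ 2 $ 1 = 0"
  shows "act_form r g a = (\<Sum>l\<le>r. \<Sum>i\<le>l. Poly_Mapping.single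
      (Poly_Mapping.single 1 (r - i) + Poly_Mapping.single 2 i)
      (a l * of_nat (r choose l) * (g$1$1) ^ (r - l) * of_nat (l choose i) * (g$1$2) ^ (l - i) * (g$2$2) ^ i))"
proof -
  have "Const (a l * of_nat (r choose l)) * (Const (g$1$1) * Var 1) ^ (r - l)
        * (Const (g$1$2) * Var 1 + Const (g$2$2) * Var 2) ^ l
      = (\<Sum>i\<le>l. Poly_Mapping.single (Poly_Mapping.single 1 (r - i) + Poly_Mapping.single 2 i)
      (a l * of_nat (r choose l) * (g$1$1) ^ (r - l) * of_nat (l choose i) * (g$1$2) ^ (l - i) * (g$2$2) ^ i))"
    if "l \<le> r" for l
  proof -
    have "Const (a l * of_nat (r choose l)) * (Const (g$1$1) * Var 1) ^ (r - l)
        * (of_nat (l choose i) * (Const (g$2$2) * Var 2) ^ i * (Const (g$1$2) * Var 1) ^ (l - i))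
      = Poly_Mapping.single (Poly_Mapping.single 1 (r - i) + Poly_Mapping.single 2 i)
      (a l * of_nat (r choose l) * (g$1$1) ^ (r - l) * of_nat (l choose i) * (g$1$2) ^ (l - i) * (g$2$2) ^ i)"
      if "i \<le> l" for i
    proof -
      have *: "(Var 1 :: cpoly) ^ (r - l) * Var 1 ^ (l - i) = Var 1 ^ (r - i)"
        using that \<open>l \<le> r\<close> by (simp flip: power_add)
      show ?thesis
        unfolding Const_Var_monomial[symmetric] Const_of_nat power_mult_distrib Const_power
          Const_mult[symmetric] by (simp only: flip: *) (simp only: mult_ac)
    qed
    note summand = this
    have binomial: "(Const (g$1$2) * Var 1 + Const (g$2$2) * Var 2) ^ l = (\<Sum>i\<le>l. of_nat (l choose i)
        * (Const (g$2$2) * Var 2) ^ i * (Const (g$1$2) * Var 1) ^ (l - i))"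
      by (subst add.commute) (rule binomial_ring)
    show ?thesis
      unfolding binomial sum_distrib_left by (rule sum.cong) (simp_all only: summand atMost_iff)
  qed
  moreover have "Const 0 = 0" by (simp add: Const_def)
  ultimately show ?thesis
    unfolding act_form_def binary_form_def assms
    by (intro sum.cong refl) (simp only: mult_zero_left add_0_right atMost_iff)
qed

text \<open>The binomial normalisation of the coefficients pays off here: with l = i + j, binom(r,
  l) binom(l, i) = binom(r, i) binom(r-i, j), and the division in \<open>act_coeff\<close> removes
  binom(r, i).\<close>

lemma act_coeff_triangular:
  fixes g :: "complex^2^2"
  assumes "g $ 2 $ 1 = 0" and i: "i \<le> r"
  shows "act_coeff r g a i = (\<Sum>j\<le>r - i. of_nat ((r - i) choose j)
           * (g$1$1) ^ (r - i - j) * (g$1$2) ^ j * (g$2$2) ^ i * a (i + j))"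
proof -
  let ?m = "\<lambda>i. Poly_Mapping.single 1 (r - i) + Poly_Mapping.single (2::nat) i"
  \<comment> \<open>The exponent of x_2 identifies the monomial, so each \<open>l\<close>
    contributes at most one term to the coefficient.\<close>
  have m: "?m j = ?m i \<longleftrightarrow> j = i" for j
  proof
    assume "?m j = ?m i"
    then have "Poly_Mapping.lookup (?m j) 2 = Poly_Mapping.lookup (?m i) 2" by simp
    then show "j = i" by (simp add: lookup_add lookup_single)
  qed simp
  define t where "t l = a l * of_nat (r choose l) * (g$1$1) ^ (r - l) * of_nat (l choose i)
      * (g$1$2) ^ (l - i) * (g$2$2) ^ i" for l
  have "Poly_Mapping.lookup (act_form r g a) (?m i) = (\<Sum>l\<le>r. if i \<le> l then t l else 0)"
    unfolding act_form_triangular[OF assms(1)] lookup_sum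
    by (rule sum.cong) (simp_all add: lookup_single m when_def t_def del: One_nat_def)
  also have "\<dots> = (\<Sum>l\<in>{i..r}. t l)"
    by (simp add: sum.If_cases atLeastAtMost_def atLeast_def Int_commute atMost_def)
  also have "\<dots> = (\<Sum>j\<le>r - i. t (i + j))"
    by (rule sum.reindex_bij_witness[of _ "\<lambda>j. i + j" "\<lambda>l. l - i"]) (use i in auto)
  also have "\<dots> / of_nat (r choose i) = (\<Sum>j\<le>r - i. of_nat ((r - i) choose j)
           * (g$1$1) ^ (r - i - j) * (g$1$2) ^ j * (g$2$2) ^ i * a (i + j))"
    unfolding sum_divide_distrib
  proof (rule sum.cong[OF refl])
    fix j assume j: "j \<in> {..r - i}"
    have "(r choose (i + j)) * ((i + j) choose i) = (r choose i) * ((r - i) choose j)"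
      using choose_mult[of i "i + j" r] j i by simp
    then have *: "of_nat (r choose (i + j)) * of_nat ((i + j) choose i)
        = (of_nat (r choose i) * of_nat ((r - i) choose j) :: complex)"
      by (metis of_nat_mult)
    have "t (i + j) = (of_nat (r choose (i + j)) * of_nat ((i + j) choose i))
        * ((g$1$1) ^ (r - i - j) * (g$1$2) ^ j * (g$2$2) ^ i * a (i + j))"
      by (simp add: t_def mult_ac)
    then have "t (i + j) = of_nat (r choose i) * of_nat ((r - i) choose j)
        * ((g$1$1) ^ (r - i - j) * (g$1$2) ^ j * (g$2$2) ^ i * a (i + j))"
      by (simp add: *)
    moreover have "(of_nat (r choose i) :: complex) \<noteq> 0" using i by simp
    ultimately show "t (i + j) / of_nat (r choose i) = of_nat ((r - i) choose j)
           * (g$1$1) ^ (r - i - j) * (g$1$2) ^ j * (g$2$2) ^ i * a (i + j)"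
      by (simp add: mult_ac)
  qed
  finally show ?thesis by (simp add: act_coeff_def)
qed

text \<open>Invariance under the matrix with rows (t, c) and (0, 1/t). The exponent of
  \<open>t\<close> collects r - i - j from the upper diagonal entry and -i from the lower one;
  integer powers keep it meaningful when it is negative.\<close>

lemma invariant_triangular:
  assumes I: "I \<in> invariants r d" and "t \<noteq> 0"
  shows "eval_poly (\<lambda>i. \<Sum>j\<le>r - i. of_nat ((r - i) choose j) * t powi (int r - 2 * int i - int j)
           * c ^ j * a (i + j)) I = eval_poly a I"
proof -
  define g :: "complex^2^2" where
    "g = (\<chi> p q. if p = 1 then (if q = 1 then t else c) else (if q = 1 then 0 else inverse t))"
  have g: "g$1$1 = t" "g$1$2 = c" "g$2$1 = 0" "g$2$2 = inverse t"
    by (simp_all add: g_def)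
  have "t ^ (r - i - j) * inverse t ^ i = t powi (int r - 2 * int i - int j)"
    if "i \<le> r" "j \<le> r - i" for i j
  proof -
    have "t powi (int r - 2 * int i - int j) = t powi (int (r - i - j)) * t powi (- int i)"
      using \<open>t \<noteq> 0\<close> that by (subst power_int_add[symmetric]) (auto intro!: arg_cong[where f = "(powi) t"])
    then show ?thesis by (simp add: power_int_minus power_inverse)
  qed
  note pow = this
  have act: "act_coeff r g a i = (\<Sum>j\<le>r - i. of_nat ((r - i) choose j)
      * t powi (int r - 2 * int i - int j) * c ^ j * a (i + j))" if i: "i \<in> {..r}" for i
  proof -
    have "act_coeff r g a i = (\<Sum>j\<le>r - i. of_nat ((r - i) choose j)
           * t ^ (r - i - j) * c ^ j * inverse t ^ i * a (i + j))"
      using act_coeff_triangular[OF g(3), of i r a] i unfolding g by simp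
    also have "\<dots> = (\<Sum>j\<le>r - i. of_nat ((r - i) choose j)
           * (t ^ (r - i - j) * inverse t ^ i) * c ^ j * a (i + j))"
      by (simp only: mult_ac)
    also have "\<dots> = (\<Sum>j\<le>r - i. of_nat ((r - i) choose j)
           * t powi (int r - 2 * int i - int j) * c ^ j * a (i + j))"
      using i by (intro sum.cong refl) (simp only: pow atMost_iff)
    finally show ?thesis .
  qed
  have "det g = 1" using \<open>t \<noteq> 0\<close> by (simp add: det_2 g)
  then have "eval_poly (act_coeff r g a) I = eval_poly a I"
    using I by (simp add: invariants_def)
  moreover have "\<forall>p\<in>Poly_Mapping.keys I. Poly_Mapping.keys p \<subseteq> {..r}"
    using I by (simp add: invariants_def)
  note eval_poly_cong[OF this act]
  ultimately show ?thesis by simp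
qed

text \<open>The diagonal matrix with entries 2 and 1/2 multiplies \<open>a i\<close> by 2^(r-2i) =
  2^r (1/4)^i. Degree and order turn this into the factor 2^(rd) 4^(-n) on the value of
  \<open>I\<close>, which must be 1 where that value is nonzero; powers of 2 determine their
  exponents.\<close>

lemma invariant_order_unique:
  assumes I: "I \<in> invariants r d" and n: "has_order n I" and nz: "eval_poly a I \<noteq> 0"
  shows "d * r = 2 * n"
proof -
  have h: "homogeneous_of_degree d I" using I by (simp add: invariants_def)
  have "(\<Sum>j\<le>r - i. of_nat ((r - i) choose j) * 2 powi (int r - 2 * int i - int j) * 0 ^ j * a (i + j))
      = 2 ^ r * ((1/4) ^ i * a i)" for i
  proof -
    have "(\<Sum>j\<le>r - i. of_nat ((r - i) choose j) * 2 powi (int r - 2 * int i - int j) * 0 ^ j * a (i + j))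
       = (\<Sum>j\<in>{0}. of_nat ((r - i) choose j) * 2 powi (int r - 2 * int i - int j) * 0 ^ j * a (i + j))"
      by (rule sum.mono_neutral_right) auto
    also have "\<dots> = 2 ^ r * ((1/4) ^ i * a i)"
      by (simp add: power_int_diff power_int_mult power_divide)
    finally show ?thesis .
  qed
  then have "eval_poly (\<lambda>i. 2 ^ r * ((1/4) ^ i * a i)) I = eval_poly a I"
    using invariant_triangular[OF I, of 2 0 a] by simp
  then have "(2 ^ r) ^ d * (1/4) ^ n * eval_poly a I = eval_poly a I"
    using eval_poly_homogeneous[OF h] eval_poly_order[OF n] by simp
  then have "(2 ^ r) ^ d * (1/4) ^ n = (1 :: complex)" using nz by simp
  then have "(2 ^ r) ^ d = (4 :: complex) ^ n"
    by (simp add: power_divide field_simps)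
  moreover have "(2 ^ r) ^ d = (2 :: complex) ^ (d * r)"
    by (simp add: mult.commute flip: power_mult)
  moreover have "(4 :: complex) ^ n = 2 ^ (2 * n)"
    by (simp add: power_mult)
  ultimately have "(2 :: complex) ^ (d * r) = 2 ^ (2 * n)" by simp
  then have "of_nat (2 ^ (d * r)) = (of_nat (2 ^ (2 * n)) :: complex)" by simp
  then have "(2 :: nat) ^ (d * r) = 2 ^ (2 * n)" by (simp only: of_nat_eq_iff)
  then show ?thesis by simp
qed

section \<open>Derivatives under the slash action\<close>

lemma open_upper_half_plane: "open upper_half_plane"
  by (simp add: upper_half_plane_def open_halfspace_Im_gt)

lemma automorphy_nonzero:
  assumes A: "A \<in> carrier SL2Z" and \<tau>: "\<tau> \<in> upper_half_plane"
  shows "automorphy A \<tau> \<noteq> 0"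
proof
  assume 0: "automorphy A \<tau> = 0"
  then have "Im (automorphy A \<tau>) = 0" by simp
  then have c: "A$2$1 = 0" using \<tau> by (auto simp: automorphy_def upper_half_plane_def)
  with 0 have "A$2$2 = 0" by (simp add: automorphy_def)
  with c A show False by (simp add: SL2Z_def det_2)
qed

lemma det_complex:
  assumes "A \<in> carrier SL2Z"
  shows "of_int (A$1$1) * of_int (A$2$2) - of_int (A$1$2) * of_int (A$2$1) = (1::complex)"
proof -
  have "A$1$1 * A$2$2 - A$1$2 * A$2$1 = 1" using assms by (simp add: SL2Z_def det_2)
  then show ?thesis by (metis of_int_1 of_int_diff of_int_mult)
qed

lemma moeb_eq: "moeb A \<tau> = (of_int (A$1$1) * \<tau> + of_int (A$1$2)) / automorphy A \<tau>"
  by (simp add: moeb_def moebius_def automorphy_def)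

text \<open>Multiplying by the conjugate of the denominator gives Im (A tau) = Im tau / |c tau +
  d|^2, the determinant being 1.\<close>

lemma moeb_upper_half_plane:
  assumes A: "A \<in> carrier SL2Z" and \<tau>: "\<tau> \<in> upper_half_plane"
  shows "moeb A \<tau> \<in> upper_half_plane"
proof -
  let ?J = "automorphy A \<tau>"
  have "A$1$1 * A$2$2 - A$1$2 * A$2$1 = 1" using A by (simp add: SL2Z_def det_2)
  then have d: "real_of_int (A$1$1) * of_int (A$2$2) - of_int (A$1$2) * of_int (A$2$1) = 1"
    by (metis of_int_1 of_int_diff of_int_mult)
  have "moeb A \<tau> = (of_int (A$1$1) * \<tau> + of_int (A$1$2)) * cnj ?J / of_real ((cmod ?J)\<^sup>2)"
    by (simp add: moeb_eq complex_div_cnj[of _ ?J])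
  then have "Im (moeb A \<tau>) = Im ((of_int (A$1$1) * \<tau> + of_int (A$1$2)) * cnj ?J) / (cmod ?J)\<^sup>2"
    by (simp only: Im_divide_of_real)
  also have "Im ((of_int (A$1$1) * \<tau> + of_int (A$1$2)) * cnj ?J)
     = (real_of_int (A$1$1) * of_int (A$2$2) - of_int (A$1$2) * of_int (A$2$1)) * Im \<tau>"
    by (simp add: automorphy_def algebra_simps)
  finally show ?thesis
    using d \<tau> automorphy_nonzero[OF A \<tau>] by (simp add: upper_half_plane_def)
qed

lemma moeb_has_field_derivative:
  assumes A: "A \<in> carrier SL2Z" and \<tau>: "\<tau> \<in> upper_half_plane"
  shows "(moeb A has_field_derivative automorphy A \<tau> powi (-2)) (at \<tau>)"
proof -
  have "((\<lambda>\<tau>. (of_int (A$1$1) * \<tau> + of_int (A$1$2)) / automorphy A \<tau>) has_field_derivative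
      (of_int (A$1$1) * automorphy A \<tau> - (of_int (A$1$1) * \<tau> + of_int (A$1$2)) * of_int (A$2$1))
        / (automorphy A \<tau> * automorphy A \<tau>)) (at \<tau>)"
    using automorphy_nonzero[OF A \<tau>] unfolding automorphy_def
    by (auto intro!: derivative_eq_intros)
  moreover have "of_int (A$1$1) * automorphy A \<tau> - (of_int (A$1$1) * \<tau> + of_int (A$1$2)) * of_int (A$2$1)
     = (1 :: complex)"
    using det_complex[OF A] by (simp add: automorphy_def algebra_simps)
  ultimately show ?thesis
    unfolding moeb_eq[abs_def] by (simp add: power_int_minus power2_eq_square divide_inverse)
qed

lemma slash_holomorphic:
  assumes A: "A \<in> carrier SL2Z" and f: "f holomorphic_on upper_half_plane"
  shows "slash k f A holomorphic_on upper_half_plane"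
proof -
  have "moeb A holomorphic_on upper_half_plane"
    using moeb_has_field_derivative[OF A] open_upper_half_plane
    by (auto simp: holomorphic_on_open)
  then have "(\<lambda>\<tau>. f (moeb A \<tau>)) holomorphic_on upper_half_plane"
    using holomorphic_on_compose_gen[OF _ f, of "moeb A" upper_half_plane] moeb_upper_half_plane[OF A]
    by (auto simp: o_def)
  then show ?thesis
    unfolding slash_def[abs_def] automorphy_def
    using automorphy_nonzero[OF A] by (auto intro!: holomorphic_intros simp: automorphy_def)
qed

text \<open>Besides the binomial coefficient this is the falling factorial (k+m-1)(k+m-2)...(k+m-j),
  written with the generalized binomial coefficient of \<open>Psi\<close> so that negative weights
  are covered.\<close>

definition deriv_coeff :: "int \<Rightarrow> nat \<Rightarrow> nat \<Rightarrow> complex" where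
  "deriv_coeff k m j = of_nat (m choose j) * (fact j * (of_int (k + int m - 1) gchoose j))"

text \<open>\<open>fact j * (x gchoose j)\<close> is a falling factorial; a factor is appended here
  at its lower end, and in the next lemma at its upper end.\<close>

lemma fact_gchoose_Suc:
  "fact (Suc j) * (x gchoose Suc j) = (x - of_nat j) * (fact j * (x gchoose j))" for x :: complex
  by (simp only: gbinomial_mult_fact prod.atLeast0_lessThan_Suc mult_ac)

lemma fact_gchoose_Suc':
  "fact (Suc j) * ((x + 1) gchoose Suc j) = (x + 1) * (fact j * (x gchoose j))" for x :: complex
  by (simp add: gbinomial_factors del: of_nat_Suc)

text \<open>The recursion produced by the product rule: the first summand comes from differentiating
  the power J^(k+2m-j), the second from differentiating the derivative of the slashed function.
  After removing the common falling factorial \<open>X\<close> it reduces to (j+1) binom(m, j+1) =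
  (m-j) binom(m, j).\<close>

lemma deriv_coeff_Suc:
  "deriv_coeff k (Suc m) (Suc j)
     = (of_int k + 2 * of_nat m - of_nat j) * deriv_coeff k m j + deriv_coeff k m (Suc j)"
proof (cases "j \<le> m")
  case True
  define X where "X = fact j * ((of_int (k + int m - 1) :: complex) gchoose j)"
  have a: "fact (Suc j) * ((of_int (k + int (Suc m) - 1) :: complex) gchoose Suc j)
      = (of_int k + of_nat m) * X"
    using fact_gchoose_Suc'[of j "of_int (k + int m - 1)"] by (simp add: X_def)
  have b: "fact (Suc j) * ((of_int (k + int m - 1) :: complex) gchoose Suc j)
      = (of_int k + of_nat m - 1 - of_nat j) * X"
    using fact_gchoose_Suc[of j "of_int (k + int m - 1)"] by (simp add: X_def)
  have "Suc j * (m choose Suc j) = (m - j) * (m choose j)"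
    using binomial_absorption[of j m] binomial_absorb_comp[of m j] by simp
  then have "of_nat (Suc j * (m choose Suc j)) = (of_nat ((m - j) * (m choose j)) :: complex)"
    by (rule arg_cong)
  then have c: "(1 + of_nat j) * of_nat (m choose Suc j) = (of_nat m - of_nat j) * (of_nat (m choose j) :: complex)"
    using True by (simp add: algebra_simps)
  show ?thesis
    unfolding deriv_coeff_def a b X_def[symmetric] binomial_Suc_Suc of_nat_add
    using arg_cong[OF c, of "\<lambda>x. x * X"] by (simp add: algebra_simps)
next
  case False
  then show ?thesis by (simp add: deriv_coeff_def binomial_eq_0)
qed

text \<open>Induction on \<open>m\<close> from f(A tau) = J^k h(tau), which is the definition of
  \<open>slash\<close> solved for \<open>f\<close>. No modularity of \<open>f\<close> enters, and
  \<open>k\<close> is any integer. The point stays arbitrary because the induction hypothesis is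
  differentiated as an identity of functions.\<close>

lemma higher_deriv_moeb:
  assumes A: "A \<in> carrier SL2Z" and f: "f holomorphic_on upper_half_plane"
    and "\<tau> \<in> upper_half_plane"
  shows "(deriv ^^ m) f (moeb A \<tau>) = (\<Sum>j\<le>m. deriv_coeff k m j * of_int (A$2$1) ^ j
           * automorphy A \<tau> powi (k + 2 * int m - int j) * (deriv ^^ (m - j)) (slash k f A) \<tau>)"
  using assms(3)
proof (induction m arbitrary: \<tau>)
  case 0
  then show ?case
    using automorphy_nonzero[OF A, of \<tau>]
    by (simp add: deriv_coeff_def slash_def power_int_minus)
next
  case (Suc m)
  define c :: complex where "c = of_int (A$2$1)"
  define J where "J = automorphy A \<tau>"
  define h where "h = slash k f A"
  define F where "F \<sigma> = (\<Sum>j\<le>m. deriv_coeff k m j * c ^ j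
           * automorphy A \<sigma> powi (k + 2 * int m - int j) * (deriv ^^ (m - j)) h \<sigma>)" for \<sigma>
  define T where "T j = c ^ j * J powi (k + 2 * int (Suc m) - int j) * (deriv ^^ (Suc m - j)) h \<tau>" for j
  have J: "J \<noteq> 0" using automorphy_nonzero[OF A Suc.prems] by (simp add: J_def)
  have h: "h holomorphic_on upper_half_plane"
    unfolding h_def by (rule slash_holomorphic[OF A f])
  have dJ: "(automorphy A has_field_derivative c) (at \<tau>)"
    unfolding automorphy_def[abs_def] c_def by (auto intro!: derivative_eq_intros)
  have "(((deriv ^^ m) f) has_field_derivative (deriv ^^ Suc m) f (moeb A \<tau>)) (at (moeb A \<tau>))"
    by (rule has_field_derivative_higher_deriv[OF f open_upper_half_plane moeb_upper_half_plane[OF A Suc.prems]])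
  from DERIV_chain2[OF this moeb_has_field_derivative[OF A Suc.prems]]
  have 1: "((\<lambda>\<sigma>. (deriv ^^ m) f (moeb A \<sigma>)) has_field_derivative
      (deriv ^^ Suc m) f (moeb A \<tau>) * J powi (-2)) (at \<tau>)"
    by (simp add: J_def)
  have "(F has_field_derivative (deriv ^^ Suc m) f (moeb A \<tau>) * J powi (-2)) (at \<tau>)"
    by (rule has_field_derivative_transform_within_open[OF 1 open_upper_half_plane Suc.prems])
      (simp add: Suc.IH F_def c_def h_def)
  moreover have "(F has_field_derivative (\<Sum>j\<le>m. deriv_coeff k m j * c ^ j *
      (of_int (k + 2 * int m - int j) * J powi (k + 2 * int m - int j - 1) * c * (deriv ^^ (m - j)) h \<tau>
        + J powi (k + 2 * int m - int j) * (deriv ^^ Suc (m - j)) h \<tau>))) (at \<tau>)"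
    unfolding F_def
  proof (rule DERIV_sum)
    fix j
    have "((\<lambda>\<sigma>. automorphy A \<sigma> powi (k + 2 * int m - int j)) has_field_derivative
        of_int (k + 2 * int m - int j) * J powi (k + 2 * int m - int j - 1) * c) (at \<tau>)"
      using DERIV_power_int[OF dJ, where n = "k + 2 * int m - int j"] J by (simp add: J_def)
    from DERIV_mult[OF this has_field_derivative_higher_deriv[OF h open_upper_half_plane Suc.prems, of "m - j"]]
    have "((\<lambda>\<sigma>. automorphy A \<sigma> powi (k + 2 * int m - int j) * (deriv ^^ (m - j)) h \<sigma>) has_field_derivative
       (of_int (k + 2 * int m - int j) * J powi (k + 2 * int m - int j - 1) * c * (deriv ^^ (m - j)) h \<tau>
        + J powi (k + 2 * int m - int j) * (deriv ^^ Suc (m - j)) h \<tau>)) (at \<tau>)"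
      by (simp add: J_def mult_ac)
    from DERIV_cmult[OF this, of "deriv_coeff k m j * c ^ j"]
    show "((\<lambda>\<sigma>. deriv_coeff k m j * c ^ j * automorphy A \<sigma> powi (k + 2 * int m - int j)
         * (deriv ^^ (m - j)) h \<sigma>) has_field_derivative
       deriv_coeff k m j * c ^ j *
       (of_int (k + 2 * int m - int j) * J powi (k + 2 * int m - int j - 1) * c * (deriv ^^ (m - j)) h \<tau>
        + J powi (k + 2 * int m - int j) * (deriv ^^ Suc (m - j)) h \<tau>)) (at \<tau>)"
      by (simp only: mult.assoc)
  qed
  ultimately have "(deriv ^^ Suc m) f (moeb A \<tau>) * J powi (-2) = (\<Sum>j\<le>m. deriv_coeff k m j * c ^ j *
      (of_int (k + 2 * int m - int j) * J powi (k + 2 * int m - int j - 1) * c * (deriv ^^ (m - j)) h \<tau>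
        + J powi (k + 2 * int m - int j) * (deriv ^^ Suc (m - j)) h \<tau>))" (is "_ = ?S")
    by (rule DERIV_unique)
  \<comment> \<open>The factor J^(-2) is the derivative of the Moebius map in the chain rule;
    multiplying by J^2 isolates the next derivative of \<open>f\<close>.\<close>
  then have "(deriv ^^ Suc m) f (moeb A \<tau>) = ?S * J\<^sup>2"
    using J by (simp add: power_int_minus field_simps)
  also have "\<dots> = (\<Sum>j\<le>m. (of_int k + 2 * of_nat m - of_nat j) * deriv_coeff k m j * T (Suc j)
      + deriv_coeff k m j * T j)"
    unfolding sum_distrib_right
  proof (rule sum.cong[OF refl])
    fix j assume j: "j \<in> {..m}"
    have p1: "J powi (k + 2 * int m - int j - 1) * J\<^sup>2 = J powi (k + 2 * int (Suc m) - int (Suc j))"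
      using J by (simp add: algebra_simps flip: power_int_add power_int_numeral)
    have p2: "J powi (k + 2 * int m - int j) * J\<^sup>2 = J powi (k + 2 * int (Suc m) - int j)"
      using J by (simp add: algebra_simps flip: power_int_add power_int_numeral)
    have "Suc (m - j) = Suc m - j" using j by auto
    then show "deriv_coeff k m j * c ^ j *
      (of_int (k + 2 * int m - int j) * J powi (k + 2 * int m - int j - 1) * c * (deriv ^^ (m - j)) h \<tau>
        + J powi (k + 2 * int m - int j) * (deriv ^^ Suc (m - j)) h \<tau>) * J\<^sup>2
      = (of_int k + 2 * of_nat m - of_nat j) * deriv_coeff k m j * T (Suc j) + deriv_coeff k m j * T j"
      unfolding T_def p1[symmetric] p2[symmetric] by (simp add: algebra_simps)
  qed
  \<comment> \<open>The added term j = m + 1 vanishes with binom(m, m+1); it prepares the index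
    shift that aligns the two sums.\<close>
  also have "\<dots> = (\<Sum>j\<le>m. (of_int k + 2 * of_nat m - of_nat j) * deriv_coeff k m j * T (Suc j))
      + (\<Sum>j\<le>Suc m. deriv_coeff k m j * T j)"
    by (simp add: sum.distrib deriv_coeff_def)
  \<comment> \<open>For j = 0 the coefficient is 1 for every \<open>m\<close>, so \<open>m\<close>
    may be replaced by \<open>Suc m\<close> in that term.\<close>
  also have "(\<Sum>j\<le>Suc m. deriv_coeff k m j * T j)
      = deriv_coeff k (Suc m) 0 * T 0 + (\<Sum>j\<le>m. deriv_coeff k m (Suc j) * T (Suc j))"
    by (simp only: sum.atMost_Suc_shift) (simp add: deriv_coeff_def)
  finally have "(deriv ^^ Suc m) f (moeb A \<tau>) = deriv_coeff k (Suc m) 0 * T 0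
      + (\<Sum>j\<le>m. deriv_coeff k (Suc m) (Suc j) * T (Suc j))"
    by (simp add: deriv_coeff_Suc distrib_right sum.distrib)
  also have "\<dots> = (\<Sum>j\<le>Suc m. deriv_coeff k (Suc m) j * T j)"
    by (simp only: sum.atMost_Suc_shift)
  finally show ?case
    by (simp only: T_def J_def c_def h_def mult.assoc)
qed

section \<open>Holomorphy at infinity\<close>

lemma holomorphic_at_infinity_cong:
  assumes "holomorphic_at_infinity g" and "\<And>\<tau>. \<tau> \<in> upper_half_plane \<Longrightarrow> h \<tau> = g \<tau>"
  shows "holomorphic_at_infinity h"
  using assms unfolding holomorphic_at_infinity_def by metis

lemma holomorphic_at_infinity_const: "holomorphic_at_infinity (\<lambda>_. c)"
  unfolding holomorphic_at_infinity_def by (intro exI[of _ 1] conjI exI[of _ "\<lambda>_. c"]) auto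

lemma local_parameter_in_ball:
  assumes "N \<ge> 1" and "\<tau> \<in> upper_half_plane"
  shows "exp (2 * of_real pi * \<i> * \<tau> / of_nat N) \<in> ball 0 1"
  using assms by (simp add: upper_half_plane_def)

lemma holomorphic_on_power_ball:
  assumes F: "F holomorphic_on ball 0 1" and N: "N \<ge> 1"
  shows "(\<lambda>z::complex. F (z ^ N)) holomorphic_on ball 0 1"
proof -
  have "(\<lambda>z::complex. z ^ N) ` ball 0 1 \<subseteq> ball 0 1"
    using N by (auto simp: norm_power power_less_one_iff)
  moreover have "(\<lambda>z::complex. z ^ N) holomorphic_on ball 0 1"
    by (intro holomorphic_intros)
  ultimately show ?thesis
    using holomorphic_on_compose_gen[OF _ F] by (simp add: o_def)
qed

text \<open>The local parameters for two widths are powers of the one for the product of the widths.\<close>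

lemma holomorphic_at_infinity_common:
  assumes "holomorphic_at_infinity g" and "holomorphic_at_infinity h"
  obtains N F G where "N \<ge> 1" and "F holomorphic_on ball 0 1" and "G holomorphic_on ball 0 1"
    and "\<And>\<tau>. \<tau> \<in> upper_half_plane \<Longrightarrow> g \<tau> = F (exp (2 * of_real pi * \<i> * \<tau> / of_nat N))"
    and "\<And>\<tau>. \<tau> \<in> upper_half_plane \<Longrightarrow> h \<tau> = G (exp (2 * of_real pi * \<i> * \<tau> / of_nat N))"
proof -
  obtain N F M G where N: "N \<ge> 1" and F: "F holomorphic_on ball 0 1"
    and g: "\<And>\<tau>. \<tau> \<in> upper_half_plane \<Longrightarrow> g \<tau> = F (exp (2 * of_real pi * \<i> * \<tau> / of_nat N))"
    and M: "M \<ge> 1" and G: "G holomorphic_on ball 0 1"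
    and h: "\<And>\<tau>. \<tau> \<in> upper_half_plane \<Longrightarrow> h \<tau> = G (exp (2 * of_real pi * \<i> * \<tau> / of_nat M))"
    using assms unfolding holomorphic_at_infinity_def by auto
  have q: "exp (2 * of_real pi * \<i> * \<tau> / of_nat a) = exp (2 * of_real pi * \<i> * \<tau> / of_nat (a * b)) ^ b"
    if "b \<ge> 1" for \<tau> a b
    using that by (simp add: field_simps flip: exp_of_nat_mult)
  show ?thesis
  proof (rule that)
    show "N * M \<ge> 1" using N M by simp
    show "(\<lambda>z. F (z ^ M)) holomorphic_on ball 0 1" "(\<lambda>z. G (z ^ N)) holomorphic_on ball 0 1"
      using F G N M by (auto intro: holomorphic_on_power_ball)
    show "g \<tau> = F (exp (2 * of_real pi * \<i> * \<tau> / of_nat (N * M)) ^ M)" if "\<tau> \<in> upper_half_plane" for \<tau>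
      using g[OF that] q[OF M, of \<tau> N] by simp
    show "h \<tau> = G (exp (2 * of_real pi * \<i> * \<tau> / of_nat (N * M)) ^ N)" if "\<tau> \<in> upper_half_plane" for \<tau>
      using h[OF that] q[OF N, of \<tau> M] by (simp add: mult.commute)
  qed
qed

lemma holomorphic_at_infinity_add:
  assumes "holomorphic_at_infinity g" and "holomorphic_at_infinity h"
  shows "holomorphic_at_infinity (\<lambda>\<tau>. g \<tau> + h \<tau>)"
proof (rule holomorphic_at_infinity_common[OF assms])
  fix N F G
  assume *: "N \<ge> 1" "F holomorphic_on ball 0 1" "G holomorphic_on ball 0 1"
    "\<And>\<tau>. \<tau> \<in> upper_half_plane \<Longrightarrow> g \<tau> = F (exp (2 * of_real pi * \<i> * \<tau> / of_nat N))"
    "\<And>\<tau>. \<tau> \<in> upper_half_plane \<Longrightarrow> h \<tau> = G (exp (2 * of_real pi * \<i> * \<tau> / of_nat N))"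
  then show ?thesis
    unfolding holomorphic_at_infinity_def
    by (intro exI[of _ N] conjI exI[of _ "\<lambda>z. F z + G z"] holomorphic_on_add) simp_all
qed

lemma holomorphic_at_infinity_mult:
  assumes "holomorphic_at_infinity g" and "holomorphic_at_infinity h"
  shows "holomorphic_at_infinity (\<lambda>\<tau>. g \<tau> * h \<tau>)"
proof (rule holomorphic_at_infinity_common[OF assms])
  fix N F G
  assume *: "N \<ge> 1" "F holomorphic_on ball 0 1" "G holomorphic_on ball 0 1"
    "\<And>\<tau>. \<tau> \<in> upper_half_plane \<Longrightarrow> g \<tau> = F (exp (2 * of_real pi * \<i> * \<tau> / of_nat N))"
    "\<And>\<tau>. \<tau> \<in> upper_half_plane \<Longrightarrow> h \<tau> = G (exp (2 * of_real pi * \<i> * \<tau> / of_nat N))"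
  then show ?thesis
    unfolding holomorphic_at_infinity_def
    by (intro exI[of _ N] conjI exI[of _ "\<lambda>z. F z * G z"] holomorphic_on_mult) simp_all
qed

lemma holomorphic_at_infinity_power:
  "holomorphic_at_infinity g \<Longrightarrow> holomorphic_at_infinity (\<lambda>\<tau>. g \<tau> ^ n)"
  by (induction n) (auto intro: holomorphic_at_infinity_const holomorphic_at_infinity_mult)

lemma holomorphic_at_infinity_sum:
  "(\<And>x. x \<in> X \<Longrightarrow> holomorphic_at_infinity (g x)) \<Longrightarrow> holomorphic_at_infinity (\<lambda>\<tau>. \<Sum>x\<in>X. g x \<tau>)"
  by (induction X rule: infinite_finite_induct)
    (auto intro: holomorphic_at_infinity_const holomorphic_at_infinity_add)

lemma holomorphic_at_infinity_prod:
  "(\<And>x. x \<in> X \<Longrightarrow> holomorphic_at_infinity (g x)) \<Longrightarrow> holomorphic_at_infinity (\<lambda>\<tau>. \<Prod>x\<in>X. g x \<tau>)"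
  by (induction X rule: infinite_finite_induct)
    (auto intro: holomorphic_at_infinity_const holomorphic_at_infinity_mult)

text \<open>If g = F(q) with q = exp (s tau), then g' = s q F'(q), again holomorphic on the disc and
  with the same width \<open>N\<close>.\<close>

lemma holomorphic_at_infinity_deriv:
  assumes "holomorphic_at_infinity g"
  shows "holomorphic_at_infinity (deriv g)"
proof -
  obtain N F where N: "N \<ge> 1" and F: "F holomorphic_on ball 0 1"
    and g: "\<And>\<tau>. \<tau> \<in> upper_half_plane \<Longrightarrow> g \<tau> = F (exp (2 * of_real pi * \<i> * \<tau> / of_nat N))"
    using assms unfolding holomorphic_at_infinity_def by auto
  define s :: complex where "s = 2 * of_real pi * \<i> / of_nat N"
  have "deriv g \<tau> = deriv F (exp (s * \<tau>)) * (exp (s * \<tau>) * s)" if \<tau>: "\<tau> \<in> upper_half_plane" for \<tau>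
  proof -
    have "exp (s * \<tau>) \<in> ball 0 1"
      using local_parameter_in_ball[OF N \<tau>] by (simp add: s_def)
    then have "(F has_field_derivative deriv F (exp (s * \<tau>))) (at (exp (s * \<tau>)))"
      using F holomorphic_derivI open_ball by blast
    moreover have "((\<lambda>\<tau>. exp (s * \<tau>)) has_field_derivative exp (s * \<tau>) * s) (at \<tau>)"
      by (auto intro!: derivative_eq_intros)
    ultimately have "((\<lambda>\<tau>. F (exp (s * \<tau>))) has_field_derivative
        deriv F (exp (s * \<tau>)) * (exp (s * \<tau>) * s)) (at \<tau>)"
      by (rule DERIV_chain2)
    then have "(g has_field_derivative deriv F (exp (s * \<tau>)) * (exp (s * \<tau>) * s)) (at \<tau>)"
      by (rule has_field_derivative_transform_within_open[OF _ open_upper_half_plane \<tau>])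
        (simp add: g s_def)
    then show ?thesis by (rule DERIV_imp_deriv)
  qed
  moreover have "(\<lambda>z. deriv F z * (z * s)) holomorphic_on ball 0 1"
    using F by (auto intro!: holomorphic_intros)
  ultimately show ?thesis
    unfolding holomorphic_at_infinity_def using N
    by (intro exI[of _ N] conjI exI[of _ "\<lambda>z. deriv F z * (z * s)"]) (auto simp: s_def)
qed

lemma holomorphic_at_infinity_higher_deriv:
  "holomorphic_at_infinity g \<Longrightarrow> holomorphic_at_infinity ((deriv ^^ n) g)"
  by (induction n) (auto intro: holomorphic_at_infinity_deriv)

section \<open>Modularity of \<open>\<Psi>\<close>\<close>

lemma Psi_upper_half_plane:
  "\<tau> \<in> upper_half_plane \<Longrightarrow> Psi r k I f \<tau>
     = eval_poly (\<lambda>i. fact i * (of_int (k + int r - 1) gchoose i) * (deriv ^^ (r - i)) f \<tau>) I"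
  by (simp add: Psi_def)

text \<open>Higher derivatives depend only on values near the point, and the upper half plane is
  open. This lets an equality known on the upper half plane, such as that between \<open>f\<close>
  and its slash by an element of \<open>\<Gamma>\<close>, be used inside \<open>Psi\<close>.\<close>

lemma Psi_cong:
  assumes "\<And>\<tau>. \<tau> \<in> upper_half_plane \<Longrightarrow> f \<tau> = g \<tau>"
  shows "Psi r k I f = Psi r k I g"
proof
  fix \<tau>
  show "Psi r k I f \<tau> = Psi r k I g \<tau>"
  proof (cases "\<tau> \<in> upper_half_plane")
    case True
    then have "eventually (\<lambda>z. f z = g z) (nhds \<tau>)"
      using assms open_upper_half_plane eventually_nhds by blast
    then have "(deriv ^^ n) f \<tau> = (deriv ^^ n) g \<tau>" for n
      by (rule higher_deriv_cong_ev) simp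
    then show ?thesis by (simp add: Psi_def)
  qed (simp add: Psi_def)
qed

lemma Psi_holomorphic:
  assumes "f holomorphic_on upper_half_plane"
  shows "Psi r k I f holomorphic_on upper_half_plane"
proof -
  have "(\<lambda>\<tau>. eval_poly (\<lambda>i. fact i * (of_int (k + int r - 1) gchoose i) * (deriv ^^ (r - i)) f \<tau>) I)
      holomorphic_on upper_half_plane"
    unfolding eval_poly_def
    by (intro holomorphic_intros assms open_upper_half_plane)
  then show ?thesis
    by (rule holomorphic_transform) (rule Psi_upper_half_plane[symmetric])
qed

lemma Psi_holomorphic_at_infinity:
  assumes "holomorphic_at_infinity f"
  shows "holomorphic_at_infinity (Psi r k I f)"
proof (rule holomorphic_at_infinity_cong[OF _ Psi_upper_half_plane])
  show "holomorphic_at_infinity (\<lambda>\<tau>. eval_poly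
      (\<lambda>i. fact i * (of_int (k + int r - 1) gchoose i) * (deriv ^^ (r - i)) f \<tau>) I)"
    unfolding eval_poly_def
    by (intro holomorphic_at_infinity_sum holomorphic_at_infinity_prod holomorphic_at_infinity_power
        holomorphic_at_infinity_mult holomorphic_at_infinity_const
        holomorphic_at_infinity_higher_deriv assms)
qed

text \<open>Two adjacent falling factorials, of length i from x and of length j from x - i, join to
  one of length i + j.\<close>

lemma fact_gchoose_add:
  "fact i * (x gchoose i) * (fact j * ((x - of_nat i) gchoose j)) = fact (i + j) * (x gchoose (i + j))"
  for x :: complex
proof (induction j)
  case (Suc j)
  have "fact i * (x gchoose i) * (fact (Suc j) * ((x - of_nat i) gchoose Suc j))
      = (x - of_nat i - of_nat j) * (fact i * (x gchoose i) * (fact j * ((x - of_nat i) gchoose j)))"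
    by (simp only: fact_gchoose_Suc mult_ac)
  also have "\<dots> = (x - of_nat (i + j)) * (fact (i + j) * (x gchoose (i + j)))"
    by (simp only: Suc.IH of_nat_add diff_diff_eq)
  also have "\<dots> = fact (i + Suc j) * (x gchoose (i + Suc j))"
    by (simp only: fact_gchoose_Suc add_Suc_right)
  finally show ?case .
qed simp

text \<open>
  The coefficients substituted by \<open>\<Psi>\<close> transform under \<open>\<tau> \<mapsto> A\<tau>\<close>, up to the factor \<open>J\<^bsup>k+r\<^esup>\<close>, by
  the unimodular triangular matrix with rows \<open>(J, c)\<close> and \<open>(0, 1/J)\<close>, where \<open>J = c\<tau> + d\<close>.
\<close>

lemma Psi_moeb:
  assumes A: "A \<in> carrier SL2Z" and f: "f holomorphic_on upper_half_plane"
    and I: "I \<in> invariants r d" and \<tau>: "\<tau> \<in> upper_half_plane"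
  shows "Psi r k I f (moeb A \<tau>)
     = automorphy A \<tau> powi (int d * (k + int r)) * Psi r k I (slash k f A) \<tau>"
proof -
  define J where "J = automorphy A \<tau>"
  define c :: complex where "c = of_int (A$2$1)"
  define X :: complex where "X = of_int (k + int r - 1)"
  define a where "a i = fact i * (X gchoose i) * (deriv ^^ (r - i)) (slash k f A) \<tau>" for i
  have J: "J \<noteq> 0" unfolding J_def by (rule automorphy_nonzero[OF A \<tau>])
  have coeff: "fact i * (X gchoose i) * (deriv ^^ (r - i)) f (moeb A \<tau>)
      = J powi (k + int r) * (\<Sum>j\<le>r - i. of_nat ((r - i) choose j)
          * J powi (int r - 2 * int i - int j) * c ^ j * a (i + j))" if i: "i \<in> {..r}" for i
  proof -
    have X: "X - of_nat i = of_int (k + int (r - i) - 1)"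
      using i by (simp add: X_def)
    have "fact i * (X gchoose i) * (deriv_coeff k (r - i) j * c ^ j
          * J powi (k + 2 * int (r - i) - int j) * (deriv ^^ (r - i - j)) (slash k f A) \<tau>)
        = J powi (k + int r) * (of_nat ((r - i) choose j)
          * J powi (int r - 2 * int i - int j) * c ^ j * a (i + j))" for j
    proof -
      \<comment> \<open>The part k + r depends on neither \<open>i\<close> nor \<open>j\<close>, so
        it scales all coefficients alike and is handled by homogeneity; the rest is the exponent in
        \<open>invariant_triangular\<close>.\<close>
      have "k + 2 * int (r - i) - int j = (k + int r) + (int r - 2 * int i - int j)"
        using i by simp
      then have "J powi (k + 2 * int (r - i) - int j)
          = J powi (k + int r) * J powi (int r - 2 * int i - int j)"
        using J by (simp only: power_int_add[of J] simp_thms)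
      moreover have "deriv_coeff k (r - i) j = of_nat ((r - i) choose j) * (fact j * ((X - of_nat i) gchoose j))"
        by (simp only: deriv_coeff_def X)
      ultimately show ?thesis
        unfolding a_def fact_gchoose_add[symmetric] diff_diff_left[symmetric]
        by (simp only: mult_ac)
    qed
    then show ?thesis
      unfolding higher_deriv_moeb[OF A f \<tau>, of _ k] sum_distrib_left
      by (simp only: J_def c_def)
  qed
  have "\<forall>p\<in>Poly_Mapping.keys I. Poly_Mapping.keys p \<subseteq> {..r}"
    using I by (simp add: invariants_def)
  note eval_poly_cong[OF this coeff]
  then have "Psi r k I f (moeb A \<tau>) = eval_poly (\<lambda>i. J powi (k + int r) * (\<Sum>j\<le>r - i.
      of_nat ((r - i) choose j) * J powi (int r - 2 * int i - int j) * c ^ j * a (i + j))) I"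
    using Psi_upper_half_plane[OF moeb_upper_half_plane[OF A \<tau>]] by (simp only: X_def)
  also have "\<dots> = (J powi (k + int r)) ^ d * eval_poly a I"
  proof -
    have "homogeneous_of_degree d I" using I by (simp add: invariants_def)
    then show ?thesis by (simp only: eval_poly_homogeneous invariant_triangular[OF I J])
  qed
  also have "(J powi (k + int r)) ^ d = J powi (int d * (k + int r))"
    by (simp only: mult.commute[of "int d"] power_int_mult power_int_of_nat)
  also have "eval_poly a I = Psi r k I (slash k f A) \<tau>"
    unfolding a_def X_def by (rule Psi_upper_half_plane[OF \<tau>, symmetric])
  finally show ?thesis by (simp only: J_def)
qed

text \<open>\<open>Psi\<close> intertwines the slash action of weight \<open>k\<close> with that of
  weight d(k+r). Elements of \<open>\<Gamma>\<close> fix \<open>f\<close>, hence its image; for the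
  other cusps the slashed image is \<open>Psi\<close> of a slashed form, whose expansion at infinity
  is known to be holomorphic.\<close>

lemma Psi_modular_forms:
  assumes \<Gamma>: "\<Gamma> \<subseteq> carrier SL2Z" and I: "I \<in> invariants r d" and f: "f \<in> modular_forms k \<Gamma>"
  shows "Psi r k I f \<in> modular_forms (int d * (k + int r)) \<Gamma>"
proof -
  let ?w = "int d * (k + int r)"
  have hol: "f holomorphic_on upper_half_plane"
    and mod: "\<And>A \<tau>. A \<in> \<Gamma> \<Longrightarrow> \<tau> \<in> upper_half_plane \<Longrightarrow> f (moeb A \<tau>) = automorphy A \<tau> powi k * f \<tau>"
    and cusp: "\<And>A. A \<in> carrier SL2Z \<Longrightarrow> holomorphic_at_infinity (slash k f A)"
    using f by (auto simp: modular_forms_def)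
  have "Psi r k I f (moeb A \<tau>) = automorphy A \<tau> powi ?w * Psi r k I f \<tau>"
    if A: "A \<in> \<Gamma>" and \<tau>: "\<tau> \<in> upper_half_plane" for A \<tau>
  proof -
    have "slash k f A \<sigma> = f \<sigma>" if "\<sigma> \<in> upper_half_plane" for \<sigma>
      using mod[OF A that] automorphy_nonzero[of A \<sigma>] A \<Gamma> that
      by (auto simp: slash_def power_int_minus)
    from Psi_cong[OF this] show ?thesis
      using Psi_moeb[OF _ hol I \<tau>] A \<Gamma> by auto
  qed
  moreover have "holomorphic_at_infinity (slash ?w (Psi r k I f) A)" if A: "A \<in> carrier SL2Z" for A
  proof (rule holomorphic_at_infinity_cong[OF Psi_holomorphic_at_infinity[OF cusp[OF A]]])
    fix \<tau> assume \<tau>: "\<tau> \<in> upper_half_plane"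
    then show "slash ?w (Psi r k I f) A \<tau> = Psi r k I (slash k f A) \<tau>"
      using Psi_moeb[OF A hol I \<tau>, of k] automorphy_nonzero[OF A \<tau>]
      by (simp add: slash_def[of ?w] power_int_minus)
  qed
  ultimately show ?thesis
    using Psi_holomorphic[OF hol] by (simp add: modular_forms_def Psi_def)
qed

lemma zero_modular_forms: "(\<lambda>_. 0) \<in> modular_forms k \<Gamma>"
  by (auto simp: modular_forms_def slash_def[abs_def] holomorphic_at_infinity_const)

text \<open>The case split isolates invariants that vanish everywhere: for these the order does not
  determine the weight, but the image is the zero function, which is modular of every
  weight.\<close>

lemma Psi_modular_forms_order:
  assumes \<Gamma>: "\<Gamma> \<subseteq> carrier SL2Z" and I: "I \<in> invariants r d" and f: "f \<in> modular_forms k \<Gamma>"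
    and n: "has_order n I"
  shows "Psi r k I f \<in> modular_forms (int d * k + 2 * int n) \<Gamma>"
proof (cases "\<forall>a. eval_poly a I = 0")
  case True
  then have "Psi r k I f = (\<lambda>_. 0)" by (simp add: Psi_def fun_eq_iff)
  then show ?thesis by (simp add: zero_modular_forms)
next
  case False
  then have "d * r = 2 * n" using invariant_order_unique[OF I n] by blast
  then have "int d * int r = 2 * int n" by (metis of_nat_mult of_nat_numeral)
  then show ?thesis using Psi_modular_forms[OF \<Gamma> I f] by (simp add: distrib_left)
qed

section \<open>The homomorphism\<close>

lemma graded_modular_forms:
  assumes "\<Gamma> \<subseteq> carrier SL2Z"
  shows "graded (\<lambda>k. modular_forms k \<Gamma>)"
proof
  fix k l :: int and f g :: "complex \<Rightarrow> complex"
  show "0 \<in> modular_forms k \<Gamma>"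
    using zero_modular_forms by (simp add: zero_fun_def)
  assume f: "f \<in> modular_forms k \<Gamma>"
  show "- f \<in> modular_forms k \<Gamma>"
    using f holomorphic_at_infinity_mult[OF holomorphic_at_infinity_const[of "-1"]]
    by (auto simp: modular_forms_def fun_Compl_def slash_def[abs_def] intro: holomorphic_on_minus)
  show "f + g \<in> modular_forms k \<Gamma>" if g: "g \<in> modular_forms k \<Gamma>"
    using f g holomorphic_at_infinity_add
    by (auto simp: modular_forms_def plus_fun_def slash_def[abs_def] distrib_left intro: holomorphic_on_add)
  show "f * g \<in> modular_forms (k + l) \<Gamma>" if g: "g \<in> modular_forms l \<Gamma>"
  proof -
    have "holomorphic_at_infinity (slash (k + l) (\<lambda>\<tau>. f \<tau> * g \<tau>) A)" if A: "A \<in> carrier SL2Z" for A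
    proof (rule holomorphic_at_infinity_cong[OF holomorphic_at_infinity_mult])
      show "holomorphic_at_infinity (slash k f A)" "holomorphic_at_infinity (slash l g A)"
        using f g A by (auto simp: modular_forms_def)
      show "slash (k + l) (\<lambda>\<tau>. f \<tau> * g \<tau>) A \<tau> = slash k f A \<tau> * slash l g A \<tau>"
        if "\<tau> \<in> upper_half_plane" for \<tau>
      proof -
        have "automorphy A \<tau> powi (- (k + l)) = automorphy A \<tau> powi (- k) * automorphy A \<tau> powi (- l)"
          using automorphy_nonzero[OF A that] by (simp flip: power_int_add)
        then show ?thesis by (simp only: slash_def mult_ac)
      qed
    qed
    moreover have "f (moeb A \<tau>) * g (moeb A \<tau>) = automorphy A \<tau> powi (k + l) * (f \<tau> * g \<tau>)"
      if "A \<in> \<Gamma>" "\<tau> \<in> upper_half_plane" for A \<tau>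
      using f g that assms automorphy_nonzero[of A \<tau>]
      by (auto simp: modular_forms_def power_int_add)
    ultimately show ?thesis
      using f g by (auto simp: modular_forms_def times_fun_def intro: holomorphic_on_mult)
  qed
qed

lemma modular_forms_ring_eq:
  "modular_forms_ring \<Gamma> = \<lparr>carrier = graded_span (\<lambda>k. modular_forms k \<Gamma>), mult = (*),
     one = (\<lambda>\<tau>. if \<tau> \<in> upper_half_plane then 1 else 0), zero = 0, add = (+)\<rparr>"
proof -
  have "(\<lambda>\<tau>. \<Sum>k\<in>K. g k \<tau>) = (\<Sum>k\<in>K. g k)" for K and g :: "int \<Rightarrow> complex \<Rightarrow> complex"
    by (induction K rule: infinite_finite_induct) (auto simp: fun_eq_iff)
  then show ?thesis
    by (simp add: modular_forms_ring_def graded_span_def plus_fun_def times_fun_def zero_fun_def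
        fun_eq_iff)
qed

lemma one_modular_forms:
  assumes "\<Gamma> \<subseteq> carrier SL2Z"
  shows "(\<lambda>\<tau>. if \<tau> \<in> upper_half_plane then 1 else 0) \<in> modular_forms 0 \<Gamma>"
proof -
  let ?e = "\<lambda>\<tau>. if \<tau> \<in> upper_half_plane then 1 else (0 :: complex)"
  have "?e holomorphic_on upper_half_plane"
    by (rule holomorphic_transform[of "\<lambda>_. 1"]) auto
  moreover have "holomorphic_at_infinity (slash 0 ?e A)" if "A \<in> carrier SL2Z" for A
    by (rule holomorphic_at_infinity_cong[OF holomorphic_at_infinity_const[of 1]])
      (simp add: slash_def moeb_upper_half_plane[OF that])
  ultimately show ?thesis
    using assms moeb_upper_half_plane by (auto simp: modular_forms_def)
qed

lemma cring_modular_forms_ring: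
  assumes "\<Gamma> \<subseteq> carrier SL2Z"
  shows "cring (modular_forms_ring \<Gamma>)"
  unfolding modular_forms_ring_eq
proof (rule graded.cring_graded_span[OF graded_modular_forms[OF assms]])
  show "(\<lambda>\<tau>. if \<tau> \<in> upper_half_plane then 1 else 0) \<in> graded_span (\<lambda>k. modular_forms k \<Gamma>)"
    by (rule component_in_graded_span) (rule one_modular_forms[OF assms])
qed (auto simp: modular_forms_def fun_eq_iff)

lemma graded_invariants: "graded (invariants r)"
proof
  fix d e :: nat and I J :: cpoly
  show "0 \<in> invariants r d"
    by (simp add: invariants_def homogeneous_of_degree_def eval_poly_zero)
  assume I: "I \<in> invariants r d"
  show "- I \<in> invariants r d"
    using I by (simp add: invariants_def homogeneous_of_degree_def eval_poly_uminus)
  show "I + J \<in> invariants r d" if J: "J \<in> invariants r d"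
    using I J keys_add[of I J]
    by (auto simp: invariants_def homogeneous_of_degree_def eval_poly_add)
  show "I * J \<in> invariants r (d + e)" if J: "J \<in> invariants r e"
  proof -
    \<comment> \<open>Summing exponents over a fixed range, rather than over the support, makes the
      degree visibly additive in products of monomials.\<close>
    have deg: "(\<Sum>i\<in>Poly_Mapping.keys p. Poly_Mapping.lookup p i) = (\<Sum>i\<le>r. Poly_Mapping.lookup p i)"
      if "Poly_Mapping.keys p \<subseteq> {..r}" for p :: "nat \<Rightarrow>\<^sub>0 nat"
      by (rule sum.mono_neutral_left) (use that in \<open>auto simp: in_keys_iff\<close>)
    have "Poly_Mapping.keys s \<subseteq> {..r} \<and> (\<Sum>i\<in>Poly_Mapping.keys s. Poly_Mapping.lookup s i) = d + e"
      if sIJ: "s \<in> Poly_Mapping.keys (I * J)" for s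
    proof -
      obtain p q where pq: "s = p + q" "p \<in> Poly_Mapping.keys I" "q \<in> Poly_Mapping.keys J"
        using sIJ keys_mult[of I J] by blast
      then have keys: "Poly_Mapping.keys p \<subseteq> {..r}" "Poly_Mapping.keys q \<subseteq> {..r}"
        using I J by (auto simp: invariants_def)
      then have s: "Poly_Mapping.keys s \<subseteq> {..r}" using keys_add[of p q] pq(1) by blast
      have "(\<Sum>i\<le>r. Poly_Mapping.lookup p i) = d" "(\<Sum>i\<le>r. Poly_Mapping.lookup q i) = e"
        using I J pq keys by (auto simp: invariants_def homogeneous_of_degree_def simp flip: deg)
      then show ?thesis
        using s deg[OF s] by (simp add: pq(1) lookup_add sum.distrib)
    qed
    then show ?thesis
      using I J by (simp add: invariants_def homogeneous_of_degree_def eval_poly_mult)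
  qed
qed

lemma invariant_ring_eq:
  "invariant_ring r = \<lparr>carrier = graded_span (invariants r), mult = (*), one = 1, zero = 0, add = (+)\<rparr>"
  by (simp add: invariant_ring_def graded_span_def)

lemma one_invariants: "1 \<in> invariants r 0"
  by (simp add: invariants_def homogeneous_of_degree_def eval_poly_one)

lemma cring_invariant_ring: "cring (invariant_ring r)"
  unfolding invariant_ring_eq
  by (rule graded.cring_graded_span[OF graded_invariants])
    (auto intro: component_in_graded_span one_invariants)

text \<open>At each point \<open>Psi\<close> is an evaluation of \<open>I\<close>, hence compatible
  with the ring operations. Membership in the target is argued through homogeneous components, using
  closure of the graded span under sums: different degrees may yield the same weight d(k+r), namely
  when k + r = 0.\<close>

lemma Psi_ring_hom:
  assumes \<Gamma>: "\<Gamma> \<subseteq> carrier SL2Z" and f: "f \<in> modular_forms k \<Gamma>"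
  shows "(\<lambda>I. Psi r k I f) \<in> ring_hom (invariant_ring r) (modular_forms_ring \<Gamma>)"
proof (rule ring_hom_memI)
  have zero: "Psi r k 0 f = 0"
    by (simp add: fun_eq_iff Psi_def eval_poly_zero)
  have add: "Psi r k (I + J) f = Psi r k I f + Psi r k J f" for I J
    by (simp add: fun_eq_iff Psi_def eval_poly_add)
  have sum: "Psi r k (\<Sum>d\<in>D. J d) f = (\<Sum>d\<in>D. Psi r k (J d) f)" for D and J :: "nat \<Rightarrow> cpoly"
    by (induction D rule: infinite_finite_induct) (simp_all add: zero add)
  fix I J
  assume "I \<in> carrier (invariant_ring r)"
  then obtain D K where I: "I = (\<Sum>d\<in>D. K d)" and K: "\<And>d. d \<in> D \<Longrightarrow> K d \<in> invariants r d"
    by (auto simp: invariant_ring_def)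
  have "Psi r k (K d) f \<in> graded_span (\<lambda>k. modular_forms k \<Gamma>)" if "d \<in> D" for d
    by (rule component_in_graded_span) (rule Psi_modular_forms[OF \<Gamma> K[OF that] f])
  then have "(\<Sum>d\<in>D. Psi r k (K d) f) \<in> graded_span (\<lambda>k. modular_forms k \<Gamma>)"
    by (rule graded.sum_graded_span[OF graded_modular_forms[OF \<Gamma>]])
  then show "Psi r k I f \<in> carrier (modular_forms_ring \<Gamma>)"
    by (simp add: modular_forms_ring_eq I sum)
  show "Psi r k (I \<otimes>\<^bsub>invariant_ring r\<^esub> J) f = Psi r k I f \<otimes>\<^bsub>modular_forms_ring \<Gamma>\<^esub> Psi r k J f"
    by (simp add: invariant_ring_def modular_forms_ring_def fun_eq_iff Psi_def eval_poly_mult)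
  show "Psi r k (I \<oplus>\<^bsub>invariant_ring r\<^esub> J) f = Psi r k I f \<oplus>\<^bsub>modular_forms_ring \<Gamma>\<^esub> Psi r k J f"
    by (simp add: invariant_ring_def modular_forms_ring_def fun_eq_iff Psi_def eval_poly_add)
next
  show "Psi r k \<one>\<^bsub>invariant_ring r\<^esub> f = \<one>\<^bsub>modular_forms_ring \<Gamma>\<^esub>"
    by (simp add: invariant_ring_def modular_forms_ring_def fun_eq_iff Psi_def eval_poly_one)
qed

theorem theorem2p1:
  fixes r :: nat and k :: int and \<Gamma> :: "(int^2^2) set"
  assumes "r \<ge> 1" and "congruence_subgroup \<Gamma>"
  shows "(\<forall>d n. \<forall>I\<in>invariants r d. \<forall>f\<in>modular_forms k \<Gamma>.
            has_order n I \<longrightarrow> Psi r k I f \<in> modular_forms (int d * k + 2 * int n) \<Gamma>)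
       \<and> (\<forall>d n. d * r = 2 * n \<longrightarrow>
            (\<lambda>(I, f). Psi r k I f) \<in> invariants r d \<times> modular_forms k \<Gamma>
              \<rightarrow> modular_forms (int d * k + 2 * int n) \<Gamma>)
       \<and> (\<forall>f\<in>modular_forms k \<Gamma>.
            ring_hom_cring (invariant_ring r) (modular_forms_ring \<Gamma>) (\<lambda>I. Psi r k I f))"
proof (intro conjI allI ballI impI)
  have \<Gamma>: "\<Gamma> \<subseteq> carrier SL2Z"
    using assms(2) by (auto simp: congruence_subgroup_def dest: subgroup.subset)
  show "Psi r k I f \<in> modular_forms (int d * k + 2 * int n) \<Gamma>"
    if "I \<in> invariants r d" "f \<in> modular_forms k \<Gamma>" "has_order n I" for d n I f
    using Psi_modular_forms_order[OF \<Gamma> that] .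
  show "(\<lambda>(I, f). Psi r k I f) \<in> invariants r d \<times> modular_forms k \<Gamma>
      \<rightarrow> modular_forms (int d * k + 2 * int n) \<Gamma>" if "d * r = 2 * n" for d n
  proof -
    \<comment> \<open>Here the relation between degree and order is given, and it turns the weight
      d(k+r) into dk + 2n.\<close>
    have "int d * int r = 2 * int n" using that by (metis of_nat_mult of_nat_numeral)
    then have "int d * (k + int r) = int d * k + 2 * int n" by (simp add: distrib_left)
    then show ?thesis using Psi_modular_forms[OF \<Gamma>, of _ r d _ k] by auto
  qed
  show "ring_hom_cring (invariant_ring r) (modular_forms_ring \<Gamma>) (\<lambda>I. Psi r k I f)"
    if "f \<in> modular_forms k \<Gamma>" for f
    by (intro ring_hom_cring.intro ring_hom_cring_axioms.intro cring_invariant_ring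
        cring_modular_forms_ring[OF \<Gamma>] Psi_ring_hom[OF \<Gamma> that])
qed

end
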